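(* Let $\Gamma$ be an infinite countable group generated by a finite symmetric set $S$, and consider an i.i.d. (site or bond) percolation on the Cayley graph $G=\mathrm{Cay}(\Gamma,S)$. For $C\subseteq\Gamma$ let $p_{n,C}=\mathbb{P}(g_n\in C)$, where $(g_n)$ is the lazy random walk on $G$ started at the identity, independent of the percolation (so that $C$ is regarded as fixed when computing $p_{n,C}$). Then almost surely, for every connected component $C$ of the percolation, the limit $$\rho(C)=\lim_{n\to\infty}p_{n,C}^{1/n}$$ exists.
   Context: An i.i.d. bond (resp. site) percolation on $G$ with parameter $p\in[0,1]$ keeps each edge (resp. vertex) of $G$ independently with probability $p$; its connected components (clusters), regarded as subsets of the vertex set $\Gamma$, are the components of the graph with vertex set $\Gamma$ and the kept edges (resp. of the subgraph of $G$ induced on the kept vertices). The lazy random walk on $G$ is the random walk which at each step stays in place with a fixed probability in $(0,1)$ and otherwise moves to a neighbour along a uniformly chosen generator in $S$. *)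

theory Defs
  imports "HOL-Probability.Probability" "HOL-Algebra.Generated_Groups"
begin

text \<open>Edges are unordered pairs. If the identity belongs to \<open>S\<close>, the singletons \<open>{x}\<close> are loops,
  which do not affect connectivity.\<close>

definition cayley_edges :: "('a, 'b) monoid_scheme \<Rightarrow> 'a set \<Rightarrow> 'a set set" where
  "cayley_edges G S = {{x, x \<otimes>\<^bsub>G\<^esub> s} | x s. x \<in> carrier G \<and> s \<in> S}"

definition connected_rel :: "'a set \<Rightarrow> 'a set set \<Rightarrow> 'a rel" where
  "connected_rel V E =
     {(x, y). x \<in> V \<and> y \<in> V \<and> (x, y) \<in> {(u, v). u \<in> V \<and> v \<in> V \<and> {u, v} \<in> E}\<^sup>*}"

definition graph_components :: "'a set \<Rightarrow> 'a set set \<Rightarrow> 'a set set" where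
  "graph_components V E = V // connected_rel V E"

text \<open>A configuration marks each edge (bond percolation) or each vertex (site percolation) as kept
  (\<open>True\<close>) or removed (\<open>False\<close>).\<close>

definition percolation :: "'i set \<Rightarrow> real \<Rightarrow> ('i \<Rightarrow> bool) measure" where
  "percolation I p = Pi\<^sub>M I (\<lambda>_. measure_pmf (bernoulli_pmf p))"

definition bond_clusters ::
    "('a, 'b) monoid_scheme \<Rightarrow> 'a set \<Rightarrow> ('a set \<Rightarrow> bool) \<Rightarrow> 'a set set" where
  "bond_clusters G S \<omega> = graph_components (carrier G) {e \<in> cayley_edges G S. \<omega> e}"

definition site_clusters ::
    "('a, 'b) monoid_scheme \<Rightarrow> 'a set \<Rightarrow> ('a \<Rightarrow> bool) \<Rightarrow> 'a set set" where
  "site_clusters G S \<omega> =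
     graph_components {x \<in> carrier G. \<omega> x} {e \<in> cayley_edges G S. \<forall>x\<in>e. \<omega> x}"

text \<open>Here \<open>a\<close> is the probability of staying in place. The walk multiplies by generators on the
  right, matching the edges of the Cayley graph.\<close>

definition lazy_step ::
    "('a, 'b) monoid_scheme \<Rightarrow> 'a set \<Rightarrow> real \<Rightarrow> 'a \<Rightarrow> 'a pmf" where
  "lazy_step G S a x =
     bind_pmf (bernoulli_pmf a)
       (\<lambda>stay. if stay then return_pmf x else map_pmf (\<lambda>s. x \<otimes>\<^bsub>G\<^esub> s) (pmf_of_set S))"

text \<open>The law of the position \<open>g\<^sub>n\<close> of the walk started at the identity.\<close>

primrec lazy_walk :: "('a, 'b) monoid_scheme \<Rightarrow> 'a set \<Rightarrow> real \<Rightarrow> nat \<Rightarrow> 'a pmf" where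
  "lazy_walk G S a 0 = return_pmf \<one>\<^bsub>G\<^esub>"
| "lazy_walk G S a (Suc n) = bind_pmf (lazy_walk G S a n) (lazy_step G S a)"

definition hit_prob ::
    "('a, 'b) monoid_scheme \<Rightarrow> 'a set \<Rightarrow> real \<Rightarrow> nat \<Rightarrow> 'a set \<Rightarrow> real" where
  "hit_prob G S a n C = measure_pmf.prob (lazy_walk G S a n) C"

end

theory Submission
  imports Defs
begin

text \<open>Let \<open>f n x\<close> be the probability that the walk started at \<open>x\<close> is at time \<open>n\<close> in the cluster of
  \<open>x\<close>. The walk from the identity reaches each vertex with positive probability and its transition
  probabilities are symmetric, so the probability of hitting the cluster of \<open>x\<close> from the identity and
  \<open>f n x\<close> have the same exponential rate (\<open>root_limit_of_mutual_domination\<close>). As there are countably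
  many vertices and the percolation is invariant under translation, it remains to show that
  \<open>ln (f n \<one>) / n\<close> almost surely converges.

  For a subgroup in place of a random cluster, \<open>f\<close> would be supermultiplicative. For a random cluster
  this fails pointwise, but the inequality \<open>f (2 * n + m) \<ge> (f n)\<^sup>2 * f m\<close> survives on average: the
  expectation of \<open>f n * sqrt (f m / f (2 * n + m))\<close> at the identity is at most \<open>1\<close>
  (\<open>expected_ret_ratio_le_1\<close>). Consider walks of three stages, of lengths \<open>n\<close>, \<open>n\<close> and \<open>m\<close>, that are in
  the cluster at the end of each stage. The mass transport principle moves the root to the end of the
  first stage; seen from there, the first two stages are two walks of length \<open>n\<close> from one point, and
  Cauchy-Schwarz bounds the product of two averages over these walks from below by the square of
  one.

  Summing over \<open>n\<close> and \<open>m\<close> with summable weights shows that almost surely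
  \<open>f (2 * n + m) \<ge> (f n)\<^sup>2 * f m\<close> holds up to a polynomial factor, for all \<open>n\<close> and \<open>m\<close> together. Taking
  \<open>m = 0\<close> and \<open>m\<close> equal to a fixed scale, one reaches all multiples of that scale by repeated
  halving; since the walk is lazy, \<open>f (n + 1) \<ge> a * f n\<close>, which covers the times in between. This gives a
  version of Fekete's lemma (\<open>almost_subadditive_convergent\<close>).\<close>

section \<open>Sequences with an exponential rate\<close>

text \<open>Since \<open>k = 2 * (k div 2) + k mod 2\<close>, the hypothesis with \<open>n * (k div 2)\<close> and
  \<open>m \<in> {0, n}\<close> bounds \<open>u (k * n)\<close> by halving \<open>k\<close>. The correction term \<open>- sqrt k\<close> strengthens the
  induction hypothesis: as \<open>2 * sqrt (k / 2)\<close> exceeds \<open>sqrt k\<close> by a fixed factor, it absorbs the error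
  of each halving, so that the total error stays linear in \<open>k\<close>, with the small slope
  \<open>7 * d * sqrt n\<close> in place of a multiple of \<open>n\<close>.\<close>

lemma halving_recursion_bound:
  fixes u :: "nat \<Rightarrow> real"
  assumes "u 0 = 0" and d: "0 \<le> d"
    and rec: "\<And>n m. 1 \<le> n \<Longrightarrow> u (2 * n + m) \<le> 2 * u n + u m + d * sqrt (real (2 * n + m))"
    and n: "1 \<le> n" and k: "1 \<le> k"
  shows "u (k * n) \<le> real k * u n + 7 * d * sqrt n * (real k - sqrt k)"
  using k
proof (induction k rule: less_induct)
  case (less k)
  define \<beta> where "\<beta> = 7 * d * sqrt n"
  have \<beta>: "0 \<le> \<beta>" using d by (simp add: \<beta>_def)
  consider "k = 1" | j where "k = 2 * j" "1 \<le> j" | j where "k = 2 * j + 1" "1 \<le> j"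
    using less.prems by (metis One_nat_def Suc_eq_plus1 Suc_leI evenE oddE add_0 gr0I mult_0_right)
  then show ?case
  proof cases
    case 1
    then show ?thesis by simp
  next
    case (2 j)
    have IH: "u (j * n) \<le> real j * u n + \<beta> * (real j - sqrt j)"
      using less.IH[of j] 2 by (simp add: \<beta>_def)
    have "u (2 * (j * n) + 0) \<le> 2 * u (j * n) + u 0 + d * sqrt (real (2 * (j * n) + 0))"
      using 2 n by (intro rec) simp
    also have "d * sqrt (real (2 * (j * n) + 0)) = \<beta> / 7 * sqrt k"
      using 2 by (simp add: \<beta>_def real_sqrt_mult)
    finally have "u (k * n) \<le> 2 * (real j * u n + \<beta> * (real j - sqrt j)) + \<beta> / 7 * sqrt k"
      using IH 2 \<open>u 0 = 0\<close> by (simp add: mult.assoc)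
    also have "\<dots> = real k * u n + \<beta> * (real k - (2 * sqrt j - sqrt k / 7))"
      using 2 by (simp add: algebra_simps)
    also have "\<dots> \<le> real k * u n + \<beta> * (real k - sqrt k)"
    proof -
      have "sqrt (real k) \<le> sqrt ((7 / 4)\<^sup>2 * real j)"
        using 2 by (intro real_sqrt_le_mono) (simp add: power2_eq_square)
      then have "sqrt k \<le> 2 * sqrt j - sqrt k / 7"
        by (simp add: real_sqrt_mult)
      then show ?thesis using \<beta> by (intro add_left_mono mult_left_mono) auto
    qed
    finally show ?thesis by (simp add: \<beta>_def)
  next
    case (3 j)
    have IH: "u (j * n) \<le> real j * u n + \<beta> * (real j - sqrt j)"
      using less.IH[of j] 3 by (simp add: \<beta>_def)
    have "u (2 * (j * n) + n) \<le> 2 * u (j * n) + u n + d * sqrt (real (2 * (j * n) + n))"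
      using 3 n by (intro rec) simp
    also have "real (2 * (j * n) + n) = real k * real n"
      using 3 by (simp add: algebra_simps)
    also have "d * sqrt (real k * real n) = \<beta> / 7 * sqrt k"
      by (simp add: \<beta>_def real_sqrt_mult)
    finally have "u (k * n) \<le> 2 * (real j * u n + \<beta> * (real j - sqrt j)) + u n + \<beta> / 7 * sqrt k"
      using IH 3 by (simp add: algebra_simps)
    also have "\<dots> = real k * u n + \<beta> * (real k - (1 + 2 * sqrt j - sqrt k / 7))"
      using 3 by (simp add: algebra_simps)
    also have "\<dots> \<le> real k * u n + \<beta> * (real k - sqrt k)"
    proof -
      \<comment> \<open>The constant \<open>7\<close> is chosen so that this estimate suffices: \<open>k \<le> 3 * j\<close> and \<open>3 \<le> (7 / 4)\<^sup>2\<close>.\<close>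
      have "sqrt (real k) \<le> sqrt ((7 / 4)\<^sup>2 * real j)"
        using 3 by (intro real_sqrt_le_mono) (simp add: power2_eq_square)
      then have "sqrt k \<le> 1 + 2 * sqrt j - sqrt k / 7"
        by (simp add: real_sqrt_mult)
      then show ?thesis using \<beta> by (intro add_left_mono mult_left_mono) auto
    qed
    finally show ?thesis by (simp add: \<beta>_def)
  qed
qed

text \<open>A variant of Fekete's lemma. Only the combinations \<open>2 * n + m\<close> are controlled, with an error of
  order \<open>sqrt\<close>; remainders modulo a fixed scale \<open>n\<close> are handled by the one-step growth bound \<open>b\<close>.
  The limit is the infimum of \<open>u n / n + 7 * d / sqrt n\<close>.\<close>

lemma almost_subadditive_convergent:
  fixes u :: "nat \<Rightarrow> real"
  assumes u0: "u 0 = 0" and nonneg: "\<And>n. 0 \<le> u n" and b: "\<And>n. u (Suc n) \<le> u n + b"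
    and d: "0 \<le> d"
    and rec: "\<And>n m. 1 \<le> n \<Longrightarrow> u (2 * n + m) \<le> 2 * u n + u m + d * sqrt (real (2 * n + m))"
  shows "convergent (\<lambda>n. u n / n)"
proof -
  have b0: "0 \<le> b" using b[of 0] nonneg[of "Suc 0"] u0 by linarith
  have lip: "u (n + j) \<le> u n + real j * b" for n j
  proof (induction j)
    case (Suc j)
    then show ?case using b[of "n + j"] by (simp add: distrib_right)
  qed simp
  define w where "w n = u n / n + 7 * d / sqrt n" for n
  define L where "L = (INF n\<in>{1..}. w n)"
  have w0: "0 \<le> w n" for n using nonneg d by (simp add: w_def)
  have bdd: "bdd_below (w ` {1..})" using w0 by (intro bdd_belowI[of _ 0]) auto
  have bound: "u N / N \<le> w n + real n * b / N" if n: "1 \<le> n" "n \<le> N" for n N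
  proof -
    define k where "k = N div n"
    define j where "j = N mod n"
    have N: "N = k * n + j" by (simp add: k_def j_def)
    have k: "1 \<le> k" using n by (simp add: k_def div_greater_zero_iff Suc_leI)
    have "u N \<le> u (k * n) + real j * b" unfolding N by (rule lip)
    also have "u (k * n) \<le> real k * u n + 7 * d * sqrt n * (real k - sqrt k)"
      by (rule halving_recursion_bound[OF u0 d rec n(1) k])
    also have "\<dots> \<le> real k * u n + 7 * d * sqrt n * real k"
      using d by (intro add_left_mono mult_left_mono) auto
    also have "\<dots> = real (k * n) * w n"
    proof -
      have "real n / sqrt (real n) = sqrt (real n)" by (rule real_div_sqrt) simp
      moreover have "real (k * n) * (7 * d / sqrt n) = 7 * d * (real n / sqrt n) * real k" by simp
      ultimately have "real (k * n) * (7 * d / sqrt n) = 7 * d * sqrt n * real k" by simp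
      then show ?thesis using n by (simp add: w_def distrib_left)
    qed
    also have "\<dots> \<le> real N * w n" using w0 N by (intro mult_right_mono) auto
    also have "real j * b \<le> real n * b"
      using b0 n by (intro mult_right_mono) (auto simp: j_def intro: less_imp_le)
    finally have "u N \<le> real N * w n + real n * b" by simp
    then show ?thesis using n by (simp add: field_simps)
  qed
  have "(\<lambda>n. u n / n) \<longlonglongrightarrow> L"
  proof (rule LIMSEQ_I)
    fix r :: real assume r: "0 < r"
    have "\<exists>n\<in>{1..}. w n < L + r / 2"
      using cINF_less_iff[of "{1..}" w "L + r / 2"] bdd r by (auto simp: L_def)
    then obtain n where n: "1 \<le> n" "w n < L + r / 2" by auto
    have l1: "(\<lambda>N. real n * b / real N) \<longlonglongrightarrow> 0" by (rule lim_const_over_n)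
    have l2: "(\<lambda>N. 7 * d / sqrt (real N)) \<longlonglongrightarrow> 0"
      by (rule tendsto_divide_0[OF tendsto_const])
         (intro filterlim_at_top_imp_at_infinity filterlim_compose[OF sqrt_at_top] filterlim_real_sequentially)
    have "\<forall>\<^sub>F N in sequentially. real n * b / real N < r / 2"
      by (rule order_tendstoD(2)[OF l1]) (use r in simp)
    moreover have "\<forall>\<^sub>F N in sequentially. 7 * d / sqrt (real N) < r"
      by (rule order_tendstoD(2)[OF l2 r])
    moreover have "\<forall>\<^sub>F N in sequentially. n \<le> N" by (rule eventually_ge_at_top)
    ultimately have "\<forall>\<^sub>F N in sequentially. norm (u N / N - L) < r"
    proof eventually_elim
      case (elim N)
      have "L \<le> w N" unfolding L_def using n elim bdd by (intro cINF_lower) auto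
      moreover have "u N / N < L + r" using bound[of n N] n elim by linarith
      ultimately show ?case using elim unfolding w_def by simp
    qed
    then show "\<exists>N0. \<forall>N\<ge>N0. norm (u N / N - L) < r" by (simp add: eventually_sequentially)
  qed
  then show ?thesis by (rule convergentI)
qed

text \<open>The multiplicative form: up to a polynomial factor, \<open>f (2 * n + m) \<ge> (f n)\<^sup>2 * f m\<close>.\<close>

lemma ln_rate_convergent:
  fixes f :: "nat \<Rightarrow> real"
  assumes f0: "f 0 = 1" and f1: "\<And>n. f n \<le> 1" and a: "0 < a" and step: "\<And>n. a * f n \<le> f (Suc n)"
    and W: "1 \<le> W"
    and rec: "\<And>n m. f n * sqrt (f m / f (2 * n + m)) \<le> W * (real n + 1)\<^sup>2 * (real m + 1)\<^sup>2"
  shows "\<exists>l. (\<lambda>n. ln (f n) / n) \<longlonglongrightarrow> l"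
proof -
  have pos: "0 < f n" for n
  proof (induction n)
    case (Suc n)
    then show ?case using step[of n] a by (meson less_le_trans mult_pos_pos)
  qed (simp add: f0)
  define u where "u n = - ln (f n)" for n
  have "convergent (\<lambda>n. u n / n)"
  proof (rule almost_subadditive_convergent[where b = "- ln a" and d = "2 * ln W + 16"])
    show "u 0 = 0" by (simp add: u_def f0)
    show "0 \<le> u n" for n using pos f1 by (simp add: u_def)
    show "u (Suc n) \<le> u n + - ln a" for n
    proof -
      have "ln (a * f n) \<le> ln (f (Suc n))" using pos a step by (subst ln_le_cancel_iff) auto
      then show ?thesis using pos[of n] a by (simp add: u_def ln_mult)
    qed
    show "0 \<le> 2 * ln W + 16" using W by simp
    fix n m :: nat assume n: "1 \<le> n"
    have ln_bound: "ln (real x + 1) \<le> 2 * sqrt y" if "x \<le> y" for x y :: nat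
    proof -
      have "ln (real x + 1) = 2 * ln (sqrt (real x + 1))" by (simp add: ln_sqrt)
      also have "ln (sqrt (real x + 1)) \<le> sqrt (real x + 1) - 1"
        by (rule ln_le_minus_one) simp
      also have "sqrt (real x + 1) \<le> sqrt (real x) + 1"
        using sqrt_add_le_add_sqrt[of "real x" 1] by simp
      also have "sqrt (real x) \<le> sqrt (real y)" using that by simp
      finally show ?thesis by simp
    qed
    have "ln (f n) + (ln (f m) - ln (f (2 * n + m))) / 2 = ln (f n * sqrt (f m / f (2 * n + m)))"
      using pos[of n] pos[of m] pos[of "2 * n + m"] by (simp add: ln_mult ln_sqrt ln_div)
    also have "\<dots> \<le> ln (W * (real n + 1)\<^sup>2 * (real m + 1)\<^sup>2)"
      using pos W rec by (subst ln_le_cancel_iff) (auto intro!: mult_pos_pos simp: less_imp_le)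
    also have "\<dots> = ln W + 2 * ln (real n + 1) + 2 * ln (real m + 1)"
      using W by (simp add: ln_mult ln_realpow)
    also have "\<dots> \<le> ln W + 8 * sqrt (real (2 * n + m))"
      using ln_bound[of n "2*n+m"] ln_bound[of m "2*n+m"] by simp
    also have "ln W \<le> ln W * sqrt (real (2 * n + m))"
      using n W mult_left_mono[of 1 "sqrt (real (2*n+m))" "ln W"] by simp
    finally have "ln (f n) + (ln (f m) - ln (f (2 * n + m))) / 2
        \<le> (ln W + 8) * sqrt (real (2 * n + m))" by (simp only: distrib_right)
    then show "u (2 * n + m) \<le> 2 * u n + u m + (2 * ln W + 16) * sqrt (real (2 * n + m))"
      unfolding u_def by argo
  qed
  then obtain l where "(\<lambda>n. u n / n) \<longlonglongrightarrow> l" by (auto simp: convergent_def)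
  from tendsto_minus[OF this] show ?thesis by (auto simp: u_def)
qed

text \<open>Two sequences that dominate each other up to a constant factor and a fixed shift of the index
  have the same exponential rate.\<close>

lemma root_limit_of_mutual_domination:
  fixes f g :: "nat \<Rightarrow> real"
  assumes f: "\<And>n. 0 < f n" and lim: "(\<lambda>n. ln (f n) / n) \<longlonglongrightarrow> l" and \<delta>: "0 < \<delta>"
    and g0: "\<And>n. 0 \<le> g n"
    and fg: "\<And>n. \<delta> * f n \<le> g (n + k)" and gf: "\<And>n. \<delta> * g n \<le> f (n + k)"
  shows "(\<lambda>n. root n (g n)) \<longlonglongrightarrow> exp l"
proof -
  have gpos: "0 < g (n + k)" for n
    using fg[of n] f[of n] \<delta> by (meson less_le_trans mult_pos_pos)
  define v where "v n = ln (g (n + k)) / real (n + k)" for n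
  have shift: "(\<lambda>n. real (n + i) / real (n + k)) \<longlonglongrightarrow> 1" for i
  proof -
    have "(\<lambda>n. 1 + (real i - real k) / real (n + k)) \<longlonglongrightarrow> 1 + 0"
      by (intro tendsto_add tendsto_const LIMSEQ_ignore_initial_segment[OF lim_const_over_n])
    moreover have "\<forall>\<^sub>F n in sequentially. 1 + (real i - real k) / real (n + k) = real (n + i) / real (n + k)"
      using eventually_gt_at_top[of 0] by eventually_elim (simp add: field_simps)
    ultimately show ?thesis unfolding add_0_right by (rule Lim_transform_eventually)
  qed
  have shifted: "(\<lambda>n. ln (f (n + i)) / real (n + k)) \<longlonglongrightarrow> l" for i
  proof -
    have "(\<lambda>n. ln (f (n + i)) / real (n + i) * (real (n + i) / real (n + k))) \<longlonglongrightarrow> l * 1"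
      using lim shift by (intro tendsto_mult LIMSEQ_ignore_initial_segment[where f = "\<lambda>n. ln (f n) / n"]) auto
    moreover have "\<forall>\<^sub>F n in sequentially. ln (f (n + i)) / real (n + i) * (real (n + i) / real (n + k))
        = ln (f (n + i)) / real (n + k)"
      using eventually_gt_at_top[of 0] by eventually_elim simp
    ultimately show ?thesis unfolding mult_1_right by (rule Lim_transform_eventually)
  qed
  have const: "(\<lambda>n. c / real (n + k)) \<longlonglongrightarrow> 0" for c
    by (rule LIMSEQ_ignore_initial_segment[OF lim_const_over_n])
  have "v \<longlonglongrightarrow> l"
  proof (rule tendsto_sandwich)
    show "(\<lambda>n. ln \<delta> / real (n + k) + ln (f (n + 0)) / real (n + k)) \<longlonglongrightarrow> l"
      using tendsto_add[OF const shifted[of 0]] by simp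
    show "(\<lambda>n. ln (f (n + 2 * k)) / real (n + k) - ln \<delta> / real (n + k)) \<longlonglongrightarrow> l"
      using tendsto_diff[OF shifted const] by simp
    show "\<forall>\<^sub>F n in sequentially. ln \<delta> / real (n + k) + ln (f (n + 0)) / real (n + k) \<le> v n"
    proof (intro always_eventually allI)
      fix n
      have "ln (\<delta> * f n) \<le> ln (g (n + k))"
        using fg f \<delta> gpos by (subst ln_le_cancel_iff) auto
      then have "ln \<delta> + ln (f n) \<le> ln (g (n + k))" using f[of n] \<delta> by (simp add: ln_mult)
      then show "ln \<delta> / real (n + k) + ln (f (n + 0)) / real (n + k) \<le> v n"
        unfolding v_def add_divide_distrib[symmetric] by (intro divide_right_mono) auto
    qed
    show "\<forall>\<^sub>F n in sequentially. v n \<le> ln (f (n + 2 * k)) / real (n + k) - ln \<delta> / real (n + k)"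
    proof (intro always_eventually allI)
      fix n
      have "ln (\<delta> * g (n + k)) \<le> ln (f (n + k + k))"
        using gf[of "n + k"] f \<delta> gpos by (subst ln_le_cancel_iff) auto
      then have "ln (g (n + k)) \<le> ln (f (n + 2 * k)) - ln \<delta>"
        using gpos[of n] \<delta> by (simp add: ln_mult mult_2 add.assoc)
      then show "v n \<le> ln (f (n + 2 * k)) / real (n + k) - ln \<delta> / real (n + k)"
        unfolding v_def diff_divide_distrib[symmetric] by (intro divide_right_mono) auto
    qed
  qed
  from tendsto_exp[OF this] have "(\<lambda>n. exp (v n)) \<longlonglongrightarrow> exp l" .
  moreover have "\<forall>\<^sub>F n in sequentially. exp (v n) = root (n + k) (g (n + k))"
    using eventually_gt_at_top[of 0]
  proof eventually_elim
    case (elim n)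
    have "root (n + k) (g (n + k)) = g (n + k) powr (1 / real (n + k))"
      using elim gpos[of n] by (intro root_powr_inverse) auto
    then show ?case using gpos[of n] by (simp add: powr_def v_def)
  qed
  ultimately have "(\<lambda>n. root (n + k) (g (n + k))) \<longlonglongrightarrow> exp l"
    by (rule Lim_transform_eventually)
  then show ?thesis by (rule LIMSEQ_offset)
qed

section \<open>The lazy random walk on a group\<close>

locale lazy_walk_on_group = group G for G :: "('a, 'b) monoid_scheme" (structure) +
  fixes S :: "'a set" and a :: real
  assumes S_carrier: "S \<subseteq> carrier G" and finite_S: "finite S" and S_nonempty: "S \<noteq> {}"
    and S_inv: "\<And>s. s \<in> S \<Longrightarrow> inv s \<in> S" and S_generates: "generate G S = carrier G"
    and a_pos: "0 < a" and a_less_1: "a < 1"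
begin

text \<open>The law of the position at time \<open>n\<close> of the walk started at an arbitrary element \<open>x\<close>.\<close>

primrec walk :: "nat \<Rightarrow> 'a \<Rightarrow> 'a pmf" where
  "walk 0 x = return_pmf x"
| "walk (Suc n) x = bind_pmf (walk n x) (lazy_step G S a)"

lemma walk_one: "walk n \<one> = lazy_walk G S a n"
  by (induction n) auto

lemma hit_prob_eq: "hit_prob G S a n A = measure_pmf.prob (walk n \<one>) A"
  by (simp add: hit_prob_def walk_one)

lemma walk_add: "walk (n + m) x = bind_pmf (walk n x) (walk m)"
  by (induction m) (simp_all add: bind_return_pmf' bind_assoc_pmf)

lemma set_lazy_step: "set_pmf (lazy_step G S a x) = insert x ((\<lambda>s. x \<otimes> s) ` S)"
  using a_pos a_less_1 finite_S S_nonempty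
  by (simp add: lazy_step_def set_pmf_bernoulli UNIV_bool)

lemma set_walk_subset: "x \<in> carrier G \<Longrightarrow> set_pmf (walk n x) \<subseteq> carrier G"
  by (induction n) (use S_carrier in \<open>auto simp: set_lazy_step\<close>)

lemma set_walkD: "y \<in> set_pmf (walk n x) \<Longrightarrow> x \<in> carrier G \<Longrightarrow> y \<in> carrier G"
  using set_walk_subset by blast

lemma finite_set_walk: "finite (set_pmf (walk n x))"
  by (induction n) (use finite_S in \<open>auto simp: set_lazy_step\<close>)

lemma lazy_step_translate:
  assumes "g \<in> carrier G" "x \<in> carrier G"
  shows "lazy_step G S a (g \<otimes> x) = map_pmf (\<lambda>y. g \<otimes> y) (lazy_step G S a x)"
proof -
  have "map_pmf (\<lambda>s. g \<otimes> x \<otimes> s) (pmf_of_set S) = map_pmf (\<lambda>s. g \<otimes> (x \<otimes> s)) (pmf_of_set S)"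
    using assms S_carrier finite_S S_nonempty by (intro map_pmf_cong) (auto simp: m_assoc)
  then show ?thesis
    unfolding lazy_step_def map_bind_pmf
    by (intro bind_pmf_cong refl) (simp add: pmf.map_comp o_def)
qed

lemma walk_translate:
  assumes g: "g \<in> carrier G" and x: "x \<in> carrier G"
  shows "walk n (g \<otimes> x) = map_pmf (\<lambda>y. g \<otimes> y) (walk n x)"
proof (induction n)
  case (Suc n)
  have "walk (Suc n) (g \<otimes> x) = bind_pmf (walk n x) (\<lambda>y. lazy_step G S a (g \<otimes> y))"
    by (simp add: Suc bind_map_pmf)
  also have "\<dots> = bind_pmf (walk n x) (\<lambda>y. map_pmf (\<lambda>z. g \<otimes> z) (lazy_step G S a y))"
    using g x by (intro bind_pmf_cong refl lazy_step_translate) (auto dest: set_walkD)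
  finally show ?case by (simp add: map_bind_pmf)
qed simp

lemma pmf_walk_translate:
  assumes g: "g \<in> carrier G" and x: "x \<in> carrier G" and y: "y \<in> carrier G"
  shows "pmf (walk n (g \<otimes> x)) (g \<otimes> y) = pmf (walk n x) y"
proof (cases "y \<in> set_pmf (walk n x)")
  case True
  have "inj_on (\<lambda>y. g \<otimes> y) (set_pmf (walk n x))"
    using g x set_walk_subset by (meson inj_on_subset inj_on_multc inj_on_cmult)
  then show ?thesis using True by (simp add: walk_translate g x pmf_map_inj)
next
  case False
  have "g \<otimes> y \<notin> set_pmf (walk n (g \<otimes> x))"
    using False g x y by (auto simp: walk_translate) (metis Units_eq Units_l_cancel set_walkD)
  with False show ?thesis by (simp add: set_pmf_eq)
qed

lemma pmf_lazy_step_sym: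
  assumes x: "x \<in> carrier G" and y: "y \<in> carrier G"
  shows "pmf (lazy_step G S a x) y = pmf (lazy_step G S a y) x"
proof -
  have gen: "pmf (map_pmf (\<lambda>s. x \<otimes> s) (pmf_of_set S)) y = indicator S (inv x \<otimes> y) / card S"
    if x: "x \<in> carrier G" and y: "y \<in> carrier G" for x y
  proof -
    have "S \<inter> (\<lambda>s. x \<otimes> s) -` {y} = S \<inter> {inv x \<otimes> y}"
      using x y S_carrier by (auto simp: inv_solve_left m_assoc[symmetric])
    then show ?thesis
      using finite_S S_nonempty
      by (simp add: pmf_map measure_pmf_of_set Int_commute indicator_def)
  qed
  have "inv x \<otimes> y \<in> S \<longleftrightarrow> inv y \<otimes> x \<in> S"
    using S_inv[of "inv x \<otimes> y"] S_inv[of "inv y \<otimes> x"] x y by (auto simp: inv_mult_group)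
  then show ?thesis
    using x y a_pos a_less_1 gen[OF x y] gen[OF y x]
    by (simp add: lazy_step_def pmf_bind indicator_def)
qed

lemma pmf_walk_sym:
  "x \<in> carrier G \<Longrightarrow> y \<in> carrier G \<Longrightarrow> pmf (walk n x) y = pmf (walk n y) x"
proof (induction n arbitrary: x y)
  case (Suc n)
  have "ennreal (pmf (walk (Suc n) x) y)
      = (\<integral>\<^sup>+z. ennreal (pmf (walk n x) z) * ennreal (pmf (lazy_step G S a z) y) \<partial>count_space UNIV)"
    by (simp add: ennreal_pmf_bind nn_integral_measure_pmf)
  also have "\<dots> = (\<integral>\<^sup>+z. ennreal (pmf (lazy_step G S a y) z) * ennreal (pmf (walk n z) x) \<partial>count_space UNIV)"
  proof (intro nn_integral_cong)
    fix z
    show "ennreal (pmf (walk n x) z) * ennreal (pmf (lazy_step G S a z) y)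
        = ennreal (pmf (lazy_step G S a y) z) * ennreal (pmf (walk n z) x)"
    proof (cases "z \<in> carrier G")
      case True
      then show ?thesis
        using Suc.IH[of x z] Suc.prems pmf_lazy_step_sym[of z y] by (simp add: mult.commute)
    next
      case False
      have "pmf (walk n x) z = 0" using False Suc.prems set_walkD by (auto simp: set_pmf_iff)
      moreover have "pmf (lazy_step G S a y) z = 0"
        using False Suc.prems set_lazy_step S_carrier by (auto simp: pmf_eq_0_set_pmf)
      ultimately show ?thesis by simp
    qed
  qed
  also have "\<dots> = ennreal (pmf (bind_pmf (walk 1 y) (walk n)) x)"
    by (simp add: ennreal_pmf_bind nn_integral_measure_pmf bind_return_pmf)
  also have "bind_pmf (walk 1 y) (walk n) = walk (Suc n) y"
    using walk_add[of 1 n y] by (simp del: walk.simps)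
  finally show ?case by simp
qed (simp add: indicator_def)

lemma pmf_walk_inv: "y \<in> carrier G \<Longrightarrow> pmf (walk n \<one>) (inv y) = pmf (walk n \<one>) y"
  using pmf_walk_translate[of "inv y" y \<one> n] pmf_walk_sym[of \<one> y n] by simp

lemma prob_walk_Suc_ge: "a * measure_pmf.prob (walk n x) A \<le> measure_pmf.prob (walk (Suc n) x) A"
proof -
  have "ennreal a * indicator A y \<le> emeasure (lazy_step G S a y) A" for y
  proof -
    have "a \<le> pmf (lazy_step G S a y) y"
      using a_pos a_less_1 by (simp add: lazy_step_def pmf_bind)
    then have "ennreal a * indicator A y \<le> ennreal (pmf (lazy_step G S a y) y) * indicator A y"
      by (intro mult_right_mono ennreal_leI) auto
    also have "\<dots> \<le> emeasure (lazy_step G S a y) A"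
      by (auto simp: indicator_def emeasure_pmf_single[symmetric] intro!: emeasure_mono)
    finally show ?thesis .
  qed
  then have "(\<integral>\<^sup>+y. ennreal a * indicator A y \<partial>walk n x) \<le> emeasure (walk (Suc n) x) A"
    by (simp add: nn_integral_mono)
  then have "ennreal a * emeasure (walk n x) A \<le> emeasure (walk (Suc n) x) A"
    by (simp add: nn_integral_cmult)
  then show ?thesis
    using a_pos by (simp add: measure_pmf.emeasure_eq_measure ennreal_mult[symmetric] del: walk.simps)
qed

lemma prob_walk_add_ge:
  "pmf (walk n x) y * measure_pmf.prob (walk m y) A \<le> measure_pmf.prob (walk (n + m) x) A"
proof -
  have "ennreal (pmf (walk n x) y) * emeasure (walk m y) A
      = (\<integral>\<^sup>+z. emeasure (walk m y) A * indicator {y} z \<partial>walk n x)"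
    by (subst nn_integral_cmult_indicator) (simp_all add: emeasure_pmf_single mult.commute)
  also have "\<dots> \<le> (\<integral>\<^sup>+z. emeasure (walk m z) A \<partial>walk n x)"
    by (intro nn_integral_mono) (simp add: indicator_def)
  also have "\<dots> = emeasure (walk (n + m) x) A" by (simp add: walk_add)
  finally show ?thesis by (simp add: measure_pmf.emeasure_eq_measure ennreal_mult[symmetric])
qed

lemma walk_reaches:
  assumes "x \<in> carrier G"
  shows "\<exists>k. 0 < pmf (walk k \<one>) x"
proof -
  have bind_pos: "z \<in> set_pmf (walk (n + m) x)"
    if "y \<in> set_pmf (walk n x)" "z \<in> set_pmf (walk m y)" for n m x y z
    using that by (auto simp: walk_add)
  have "x \<in> generate G S" using assms S_generates by simp
  then have "\<exists>k. x \<in> set_pmf (walk k \<one>)"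
  proof (induction rule: generate.induct)
    case one
    have "\<one> \<in> set_pmf (walk 0 \<one>)" by simp
    then show ?case by blast
  next
    case (incl h)
    then have "h \<in> set_pmf (walk 1 \<one>)"
      using S_carrier by (force simp: set_lazy_step bind_return_pmf)
    then show ?case by blast
  next
    case (inv h)
    then have "inv h \<in> set_pmf (walk 1 \<one>)"
      using S_carrier S_inv[of h] by (force simp: set_lazy_step bind_return_pmf)
    then show ?case by blast
  next
    case (eng h1 h2)
    then obtain k1 k2 where k: "h1 \<in> set_pmf (walk k1 \<one>)" "h2 \<in> set_pmf (walk k2 \<one>)" by blast
    have h: "h1 \<in> carrier G" using eng S_generates by simp
    have "h1 \<otimes> h2 \<in> set_pmf (walk k2 h1)"
      using walk_translate[OF h one_closed, of k2] k h by auto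
    then show ?case using bind_pos k(1) by blast
  qed
  then show ?thesis by (meson pmf_positive)
qed

end

section \<open>Invariant random graphs on the group\<close>

text \<open>A random graph with vertex set \<open>carrier G\<close>, whose symmetric adjacency relation in the
  configuration \<open>\<omega>\<close> is \<open>Q \<omega>\<close>, and whose law is invariant under left translation: \<open>\<theta> g\<close> is a measure
  preserving map of configurations, and translation by \<open>g\<close> is an isomorphism from the graph of
  \<open>\<theta> g \<omega>\<close> to that of \<open>\<omega>\<close>. The maps \<open>\<theta> g\<close> need not form an action.\<close>

locale invariant_random_graph = lazy_walk_on_group G S a + prob_space M
  for G :: "('a, 'b) monoid_scheme" (structure) and S a and M :: "'w measure" +
  fixes Q :: "'w \<Rightarrow> 'a rel" and \<theta> :: "'a \<Rightarrow> 'w \<Rightarrow> 'w"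
  assumes countable_carrier: "countable (carrier G)"
    and Q_carrier: "Q \<omega> \<subseteq> carrier G \<times> carrier G" and Q_sym: "sym (Q \<omega>)"
    and Q_measurable: "\<And>x y. x \<in> carrier G \<Longrightarrow> y \<in> carrier G \<Longrightarrow> {\<omega> \<in> space M. (x, y) \<in> Q \<omega>} \<in> sets M"
    and shift_measurable: "\<And>g. g \<in> carrier G \<Longrightarrow> \<theta> g \<in> measurable M M"
    and shift_invariant: "\<And>g. g \<in> carrier G \<Longrightarrow> distr M M (\<theta> g) = M"
    and Q_shift: "\<And>g x y \<omega>. g \<in> carrier G \<Longrightarrow> x \<in> carrier G \<Longrightarrow> y \<in> carrier G \<Longrightarrow> \<omega> \<in> space M
      \<Longrightarrow> (x, y) \<in> Q (\<theta> g \<omega>) \<longleftrightarrow> (g \<otimes> x, g \<otimes> y) \<in> Q \<omega>"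
begin

text \<open>The connected component of the vertex \<open>x\<close>.\<close>

definition cluster :: "'w \<Rightarrow> 'a \<Rightarrow> 'a set" where
  "cluster \<omega> x = (Q \<omega>)\<^sup>* `` {x}"

lemma cluster_self: "x \<in> cluster \<omega> x"
  by (simp add: cluster_def)

lemma cluster_sym: "y \<in> cluster \<omega> x \<longleftrightarrow> x \<in> cluster \<omega> y"
  using sym_rtrancl[OF Q_sym] by (auto simp: cluster_def dest: symD)

lemma cluster_eq: "y \<in> cluster \<omega> x \<Longrightarrow> cluster \<omega> y = cluster \<omega> x"
  using sym_rtrancl[OF Q_sym, of \<omega>]
  by (auto simp: cluster_def dest: symD intro: rtrancl_trans)

lemma cluster_shift:
  assumes g: "g \<in> carrier G" and x: "x \<in> carrier G" and y: "y \<in> carrier G" and \<omega>: "\<omega> \<in> space M"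
  shows "y \<in> cluster (\<theta> g \<omega>) x \<longleftrightarrow> g \<otimes> y \<in> cluster \<omega> (g \<otimes> x)"
proof
  assume "y \<in> cluster (\<theta> g \<omega>) x"
  then have "(x, y) \<in> (Q (\<theta> g \<omega>))\<^sup>*" by (simp add: cluster_def)
  then have "(g \<otimes> x, g \<otimes> y) \<in> (Q \<omega>)\<^sup>*"
  proof induction
    case (step y z)
    then show ?case using Q_carrier Q_shift[OF g _ _ \<omega>] by (blast intro: rtrancl_into_rtrancl)
  qed simp
  then show "g \<otimes> y \<in> cluster \<omega> (g \<otimes> x)" by (simp add: cluster_def)
next
  assume "g \<otimes> y \<in> cluster \<omega> (g \<otimes> x)"
  then have "(g \<otimes> x, g \<otimes> y) \<in> (Q \<omega>)\<^sup>*" by (simp add: cluster_def)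
  then have "(inv g \<otimes> (g \<otimes> x), inv g \<otimes> (g \<otimes> y)) \<in> (Q (\<theta> g \<omega>))\<^sup>*"
  proof induction
    case (step y z)
    have yz: "y \<in> carrier G" "z \<in> carrier G" using step Q_carrier by auto
    have "g \<otimes> (inv g \<otimes> y) = y" "g \<otimes> (inv g \<otimes> z) = z"
      using g yz by (simp_all add: m_assoc[symmetric])
    then have "(inv g \<otimes> y, inv g \<otimes> z) \<in> Q (\<theta> g \<omega>)"
      using Q_shift[of g "inv g \<otimes> y" "inv g \<otimes> z" \<omega>] g yz \<omega> step by simp
    with step show ?case by (blast intro: rtrancl_into_rtrancl)
  qed simp
  then show "y \<in> cluster (\<theta> g \<omega>) x"
    using g x y by (simp add: cluster_def m_assoc[symmetric])
qed

lemma cluster_measurable: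
  assumes "x \<in> carrier G" "y \<in> carrier G"
  shows "{\<omega> \<in> space M. y \<in> cluster \<omega> x} \<in> sets M"
proof -
  have pow: "{\<omega> \<in> space M. (x, y) \<in> Q \<omega> ^^ n} \<in> sets M" if "y \<in> carrier G" for n y
    using that
  proof (induction n arbitrary: y)
    case 0
    then show ?case by simp
  next
    case (Suc n)
    have "{\<omega> \<in> space M. (x, y) \<in> Q \<omega> ^^ Suc n}
        = {\<omega> \<in> space M. \<exists>z\<in>carrier G. (x, z) \<in> Q \<omega> ^^ n \<and> (z, y) \<in> Q \<omega>}"
      using Q_carrier by (auto simp: relcomp_unfold)
    also have "\<dots> \<in> sets M"
      using Suc countable_carrier Q_measurable
      by (intro sets.sets_Collect_countable_Ex' sets.sets_Collect_conj) auto
    finally show ?case .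
  qed
  have "{\<omega> \<in> space M. y \<in> cluster \<omega> x} = {\<omega> \<in> space M. \<exists>n. (x, y) \<in> Q \<omega> ^^ n}"
    by (auto simp: cluster_def rtrancl_power)
  also have "\<dots> \<in> sets M"
    using pow assms by (intro sets.sets_Collect_countable_Ex) auto
  finally show ?thesis .
qed

lemma indicator_cluster_measurable:
  assumes "x \<in> carrier G" "y \<in> carrier G"
  shows "(\<lambda>\<omega>. indicator (cluster \<omega> x) y :: ennreal) \<in> borel_measurable M"
proof -
  have "(\<lambda>\<omega>. indicator (cluster \<omega> x) y :: ennreal) = (\<lambda>\<omega>. if y \<in> cluster \<omega> x then 1 else 0)"
    by (auto simp: indicator_def)
  also have "\<dots> \<in> borel_measurable M"
    using cluster_measurable[OF assms] by (intro measurable_If) (auto simp: pred_def)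
  finally show ?thesis .
qed

section \<open>Return probabilities and mass transport\<close>

text \<open>The averaging operator of the walk, restricted to clusters: the expectation of \<open>h\<close> at the
  position at time \<open>n\<close> of the walk from \<open>x\<close>, on the event that this position lies in the cluster
  of \<open>x\<close>. It acts on functions with values in \<open>ennreal\<close>, so that no integrability conditions are
  needed.\<close>

definition cluster_avg :: "nat \<Rightarrow> 'w \<Rightarrow> ('a \<Rightarrow> ennreal) \<Rightarrow> 'a \<Rightarrow> ennreal" where
  "cluster_avg n \<omega> h x = (\<integral>\<^sup>+y. h y * indicator (cluster \<omega> x) y \<partial>walk n x)"

text \<open>The probability that the walk started at \<open>x\<close> is in the cluster of \<open>x\<close> at time \<open>n\<close>.\<close>

definition ret :: "nat \<Rightarrow> 'w \<Rightarrow> 'a \<Rightarrow> real" where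
  "ret n \<omega> x = measure_pmf.prob (walk n x) (cluster \<omega> x)"

lemma ennreal_ret: "ennreal (ret n \<omega> x) = cluster_avg n \<omega> (\<lambda>_. 1) x"
  by (simp add: ret_def cluster_avg_def measure_pmf.emeasure_eq_measure)

lemma cluster_avg_shift:
  assumes g: "g \<in> carrier G" and x: "x \<in> carrier G" and \<omega>: "\<omega> \<in> space M"
    and hk: "\<And>y. y \<in> carrier G \<Longrightarrow> h y = k (g \<otimes> y)"
  shows "cluster_avg n (\<theta> g \<omega>) h x = cluster_avg n \<omega> k (g \<otimes> x)"
proof -
  have "cluster_avg n \<omega> k (g \<otimes> x)
      = (\<integral>\<^sup>+y. k (g \<otimes> y) * indicator (cluster \<omega> (g \<otimes> x)) (g \<otimes> y) \<partial>walk n x)"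
    by (simp add: cluster_avg_def walk_translate g x)
  also have "\<dots> = cluster_avg n (\<theta> g \<omega>) h x"
    unfolding cluster_avg_def
    using g x \<omega> hk
    by (intro nn_integral_cong_AE)
       (auto simp: AE_measure_pmf_iff indicator_def cluster_shift dest: set_walkD)
  finally show ?thesis by simp
qed

lemma cluster_avg_measurable:
  assumes x: "x \<in> carrier G" and h: "\<And>y. y \<in> carrier G \<Longrightarrow> (\<lambda>\<omega>. h \<omega> y) \<in> borel_measurable M"
  shows "(\<lambda>\<omega>. cluster_avg n \<omega> (h \<omega>) x) \<in> borel_measurable M"
  unfolding cluster_avg_def using x h
  by (subst nn_integral_measure_pmf_finite[OF finite_set_walk])
     (auto intro!: borel_measurable_sum borel_measurable_times_ennreal indicator_cluster_measurable
       dest: set_walkD)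

lemma ret_le_1: "ret n \<omega> x \<le> 1"
  by (simp add: ret_def)

lemma ret_0: "ret 0 \<omega> x = 1"
  by (simp add: ret_def cluster_self)

lemma ret_measurable:
  assumes x: "x \<in> carrier G"
  shows "(\<lambda>\<omega>. ret n \<omega> x) \<in> borel_measurable M"
proof -
  have "(\<lambda>\<omega>. enn2real (cluster_avg n \<omega> (\<lambda>_. 1) x)) \<in> borel_measurable M"
    by (rule measurable_compose[OF cluster_avg_measurable borel_measurable_enn2real]) (auto simp: x)
  then show ?thesis by (simp flip: ennreal_ret add: ret_def)
qed

lemma ret_shift:
  assumes "g \<in> carrier G" "x \<in> carrier G" "\<omega> \<in> space M"
  shows "ret n (\<theta> g \<omega>) x = ret n \<omega> (g \<otimes> x)"
proof -
  have "ennreal (ret n (\<theta> g \<omega>) x) = ennreal (ret n \<omega> (g \<otimes> x))"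
    unfolding ennreal_ret using assms by (intro cluster_avg_shift) auto
  then show ?thesis by (simp add: ret_def)
qed

lemma ret_Suc_ge: "a * ret n \<omega> x \<le> ret (Suc n) \<omega> x"
  unfolding ret_def by (rule prob_walk_Suc_ge)

lemma ret_pos: "0 < ret n \<omega> x"
proof (induction n)
  case (Suc n)
  then show ?case using ret_Suc_ge[of n \<omega> x] a_pos by (meson less_le_trans mult_pos_pos)
qed (simp add: ret_0)

text \<open>The left-hand side is the probability of being in the cluster at both times \<open>n\<close> and
  \<open>n + m\<close>.\<close>

lemma cluster_avg_ret_le: "cluster_avg n \<omega> (\<lambda>y. ennreal (ret m \<omega> y)) x \<le> ennreal (ret (n + m) \<omega> x)"
proof -
  have "cluster_avg n \<omega> (\<lambda>y. ennreal (ret m \<omega> y)) x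
      \<le> (\<integral>\<^sup>+y. emeasure (walk m y) (cluster \<omega> x) \<partial>walk n x)"
    unfolding cluster_avg_def
    by (intro nn_integral_mono)
       (auto simp: indicator_def ret_def measure_pmf.emeasure_eq_measure dest: cluster_eq)
  also have "\<dots> = ennreal (ret (n + m) \<omega> x)"
    by (simp add: ret_def walk_add flip: measure_pmf.emeasure_eq_measure)
  finally show ?thesis .
qed

lemma cluster_avg_mono: "(\<And>y. h y \<le> k y) \<Longrightarrow> cluster_avg n \<omega> h x \<le> cluster_avg n \<omega> k x"
  unfolding cluster_avg_def by (intro nn_integral_mono mult_right_mono) auto

text \<open>The mass transport principle: if \<open>F \<omega> x y\<close> is the mass sent from \<open>x\<close> to \<open>y\<close>, by a rule that is
  invariant under translation, then the expected mass sent by the identity equals the expected mass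
  that it receives. Both are weighted by the transition probabilities of the walk, which are
  symmetric; translation by \<open>inv y\<close> carries the pair \<open>(y, \<one>)\<close> to \<open>(\<one>, inv y)\<close>.\<close>

lemma mass_transport:
  fixes F :: "'w \<Rightarrow> 'a \<Rightarrow> 'a \<Rightarrow> ennreal"
  assumes F: "\<And>x y. x \<in> carrier G \<Longrightarrow> y \<in> carrier G \<Longrightarrow> (\<lambda>\<omega>. F \<omega> x y) \<in> borel_measurable M"
    and F_shift: "\<And>g x y \<omega>. g \<in> carrier G \<Longrightarrow> x \<in> carrier G \<Longrightarrow> y \<in> carrier G \<Longrightarrow> \<omega> \<in> space M
      \<Longrightarrow> F (\<theta> g \<omega>) x y = F \<omega> (g \<otimes> x) (g \<otimes> y)"
  shows "(\<integral>\<^sup>+\<omega>. (\<integral>\<^sup>+y. F \<omega> \<one> y \<partial>walk n \<one>) \<partial>M) = (\<integral>\<^sup>+\<omega>. (\<integral>\<^sup>+y. F \<omega> y \<one> \<partial>walk n \<one>) \<partial>M)"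
proof -
  define A where "A = set_pmf (walk n \<one>)"
  have A: "finite A" "A \<subseteq> carrier G"
    using finite_set_walk set_walk_subset by (auto simp: A_def)
  have expand: "(\<integral>\<^sup>+\<omega>. (\<integral>\<^sup>+y. H \<omega> y \<partial>walk n \<one>) \<partial>M)
      = (\<Sum>y\<in>A. (\<integral>\<^sup>+\<omega>. H \<omega> y \<partial>M) * ennreal (pmf (walk n \<one>) y))"
    if "\<And>y. y \<in> carrier G \<Longrightarrow> (\<lambda>\<omega>. H \<omega> y) \<in> borel_measurable M" for H
  proof -
    have H: "(\<lambda>\<omega>. H \<omega> y) \<in> borel_measurable M" if "y \<in> A" for y
      using A that \<open>\<And>y. y \<in> carrier G \<Longrightarrow> _\<close> by auto
    have "(\<integral>\<^sup>+\<omega>. (\<integral>\<^sup>+y. H \<omega> y \<partial>walk n \<one>) \<partial>M)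
        = (\<integral>\<^sup>+\<omega>. (\<Sum>y\<in>A. H \<omega> y * ennreal (pmf (walk n \<one>) y)) \<partial>M)"
      by (subst nn_integral_measure_pmf_finite) (auto simp: finite_set_walk A_def)
    also have "\<dots> = (\<Sum>y\<in>A. (\<integral>\<^sup>+\<omega>. H \<omega> y * ennreal (pmf (walk n \<one>) y) \<partial>M))"
      using H by (intro nn_integral_sum borel_measurable_times_ennreal) auto
    also have "\<dots> = (\<Sum>y\<in>A. (\<integral>\<^sup>+\<omega>. H \<omega> y \<partial>M) * ennreal (pmf (walk n \<one>) y))"
      using H by (intro sum.cong refl nn_integral_multc) auto
    finally show ?thesis .
  qed
  have reflect: "(\<integral>\<^sup>+\<omega>. F \<omega> y \<one> \<partial>M) = (\<integral>\<^sup>+\<omega>. F \<omega> \<one> (inv y) \<partial>M)" if y: "y \<in> carrier G" for y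
  proof -
    have "(\<integral>\<^sup>+\<omega>. F \<omega> y \<one> \<partial>M) = (\<integral>\<^sup>+\<omega>. F \<omega> y \<one> \<partial>distr M M (\<theta> (inv y)))"
      using y by (simp add: shift_invariant)
    also have "\<dots> = (\<integral>\<^sup>+\<omega>. F (\<theta> (inv y) \<omega>) y \<one> \<partial>M)"
      using y by (intro nn_integral_distr shift_measurable) (auto simp: F shift_invariant)
    also have "\<dots> = (\<integral>\<^sup>+\<omega>. F \<omega> \<one> (inv y) \<partial>M)"
      using y by (intro nn_integral_cong) (simp add: F_shift)
    finally show ?thesis .
  qed
  have "inv y \<in> A" if "y \<in> A" for y
    using pmf_walk_inv[of y n] A(2) that by (auto simp: A_def set_pmf_iff)
  then have bij: "bij_betw (m_inv G) A A"
    using A(2) by (intro bij_betw_byWitness[where f' = "m_inv G"]) (auto simp: subset_iff)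
  have "(\<integral>\<^sup>+\<omega>. (\<integral>\<^sup>+y. F \<omega> y \<one> \<partial>walk n \<one>) \<partial>M)
      = (\<Sum>y\<in>A. (\<integral>\<^sup>+\<omega>. F \<omega> y \<one> \<partial>M) * ennreal (pmf (walk n \<one>) y))"
    by (rule expand) (simp add: F)
  also have "\<dots> = (\<Sum>y\<in>A. (\<integral>\<^sup>+\<omega>. F \<omega> \<one> (inv y) \<partial>M) * ennreal (pmf (walk n \<one>) (inv y)))"
    using A(2) by (intro sum.cong refl) (simp add: reflect pmf_walk_inv subset_iff)
  also have "\<dots> = (\<Sum>y\<in>A. (\<integral>\<^sup>+\<omega>. F \<omega> \<one> y \<partial>M) * ennreal (pmf (walk n \<one>) y))"
    by (rule sum.reindex_bij_betw[OF bij])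
  also have "\<dots> = (\<integral>\<^sup>+\<omega>. (\<integral>\<^sup>+y. F \<omega> \<one> y \<partial>walk n \<one>) \<partial>M)"
    by (rule expand[symmetric]) (simp add: F)
  finally show ?thesis by simp
qed

lemma cluster_avg_Cauchy_Schwarz:
  "(cluster_avg n \<omega> (\<lambda>y. h y * k y) x)\<^sup>2
    \<le> cluster_avg n \<omega> (\<lambda>y. (h y)\<^sup>2) x * cluster_avg n \<omega> (\<lambda>y. (k y)\<^sup>2) x"
proof -
  have idem: "(indicator A y :: ennreal)\<^sup>2 = indicator A y" for A and y :: 'a
    by (simp add: indicator_def)
  have "cluster_avg n \<omega> (\<lambda>y. h y * k y) x
      = (\<integral>\<^sup>+y. (h y * indicator (cluster \<omega> x) y) * (k y * indicator (cluster \<omega> x) y) \<partial>walk n x)"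
    unfolding cluster_avg_def by (intro nn_integral_cong) (simp add: indicator_def)
  then show ?thesis
    using Cauchy_Schwarz_nn_integral[of "\<lambda>y. h y * indicator (cluster \<omega> x) y" "measure_pmf (walk n x)"
        "\<lambda>y. k y * indicator (cluster \<omega> x) y"]
    by (simp add: cluster_avg_def power_mult_distrib idem)
qed

text \<open>The key estimate. Write \<open>T\<close> for \<open>cluster_avg n\<close>, \<open>f\<close> for \<open>ret m\<close> and \<open>R\<close> for
  \<open>ret (2 * n + m)\<close>. As \<open>T (T f) \<le> R\<close>, the expectation of \<open>(1 / R) * T (T f)\<close> at the identity is at
  most \<open>1\<close>. By mass transport it equals the expectation of \<open>T (1 / R) * T f\<close>, which by
  Cauchy-Schwarz for the walk is at least that of \<open>(T h)\<^sup>2\<close> with \<open>h = sqrt (f / R)\<close>. By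
  Cauchy-Schwarz for the probability measure \<open>T h\<close> has expectation at most \<open>1\<close>, and by mass transport
  again this is the expectation of \<open>h * T 1 = h * ret n\<close>.\<close>

lemma expected_ret_ratio_le_1:
  "(\<integral>\<^sup>+\<omega>. ennreal (ret n \<omega> \<one> * sqrt (ret m \<omega> \<one> / ret (2 * n + m) \<omega> \<one>)) \<partial>M) \<le> 1"
proof -
  define R where "R \<omega> x = ret (2 * n + m) \<omega> x" for \<omega> x
  define f where "f \<omega> x = ennreal (ret m \<omega> x)" for \<omega> x
  define \<phi> where "\<phi> \<omega> x = ennreal (1 / R \<omega> x)" for \<omega> x
  define h where "h \<omega> x = ennreal (sqrt (ret m \<omega> x / R \<omega> x))" for \<omega> x
  have R_pos: "0 < R \<omega> x" for \<omega> x by (simp add: R_def ret_pos)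
  have [measurable]: "(\<lambda>\<omega>. f \<omega> x) \<in> borel_measurable M" "(\<lambda>\<omega>. \<phi> \<omega> x) \<in> borel_measurable M"
    "(\<lambda>\<omega>. h \<omega> x) \<in> borel_measurable M" if "x \<in> carrier G" for x
    using ret_measurable[OF that] unfolding f_def \<phi>_def h_def R_def by measurable
  have shift: "f (\<theta> g \<omega>) x = f \<omega> (g \<otimes> x)" "\<phi> (\<theta> g \<omega>) x = \<phi> \<omega> (g \<otimes> x)" "h (\<theta> g \<omega>) x = h \<omega> (g \<otimes> x)"
    if "g \<in> carrier G" "x \<in> carrier G" "\<omega> \<in> space M" for g x \<omega>
    using that by (simp_all add: f_def \<phi>_def h_def R_def ret_shift)
  have ind_shift: "(indicator (cluster (\<theta> g \<omega>) x) y :: ennreal) = indicator (cluster \<omega> (g \<otimes> x)) (g \<otimes> y)"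
    if "g \<in> carrier G" "x \<in> carrier G" "y \<in> carrier G" "\<omega> \<in> space M" for g x y \<omega>
    using that by (simp add: indicator_def cluster_shift)
  have two_steps: "cluster_avg n \<omega> (cluster_avg n \<omega> (f \<omega>)) x \<le> ennreal (R \<omega> x)" for \<omega> x
  proof -
    have "cluster_avg n \<omega> (cluster_avg n \<omega> (f \<omega>)) x \<le> cluster_avg n \<omega> (\<lambda>y. ennreal (ret (n + m) \<omega> y)) x"
      unfolding f_def by (intro cluster_avg_mono cluster_avg_ret_le)
    also have "\<dots> \<le> ennreal (ret (n + (n + m)) \<omega> x)" by (rule cluster_avg_ret_le)
    finally show ?thesis by (simp add: R_def mult_2 add.assoc)
  qed
  have "(\<integral>\<^sup>+\<omega>. (cluster_avg n \<omega> (h \<omega>) \<one>)\<^sup>2 \<partial>M)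
      \<le> (\<integral>\<^sup>+\<omega>. cluster_avg n \<omega> (\<phi> \<omega>) \<one> * cluster_avg n \<omega> (f \<omega>) \<one> \<partial>M)"
  proof (intro nn_integral_mono)
    fix \<omega>
    have split: "h \<omega> y = ennreal (sqrt (1 / R \<omega> y)) * ennreal (sqrt (ret m \<omega> y))" for y
      using R_pos[of \<omega> y] ret_pos[of m \<omega> y]
      by (simp add: h_def real_sqrt_divide ennreal_mult[symmetric] less_imp_le)
    have sq: "(ennreal (sqrt (1 / R \<omega> y)))\<^sup>2 = \<phi> \<omega> y" "(ennreal (sqrt (ret m \<omega> y)))\<^sup>2 = f \<omega> y" for y
      using R_pos[of \<omega> y] ret_pos[of m \<omega> y]
      by (simp_all add: \<phi>_def f_def ennreal_power less_imp_le)
    show "(cluster_avg n \<omega> (h \<omega>) \<one>)\<^sup>2 \<le> cluster_avg n \<omega> (\<phi> \<omega>) \<one> * cluster_avg n \<omega> (f \<omega>) \<one>"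
      using cluster_avg_Cauchy_Schwarz[of n \<omega> "\<lambda>y. ennreal (sqrt (1 / R \<omega> y))"
          "\<lambda>y. ennreal (sqrt (ret m \<omega> y))" \<one>]
      by (simp only: split[symmetric] sq)
  qed
  also have "\<dots> = (\<integral>\<^sup>+\<omega>. (\<integral>\<^sup>+y. \<phi> \<omega> y * (cluster_avg n \<omega> (f \<omega>) \<one> * indicator (cluster \<omega> y) \<one>) \<partial>walk n \<one>) \<partial>M)"
    unfolding cluster_avg_def[of n _ "\<phi> _"]
    by (intro nn_integral_cong, subst nn_integral_multc[symmetric])
       (auto intro!: nn_integral_cong simp: indicator_def cluster_sym mult_ac)
  also have "\<dots> = (\<integral>\<^sup>+\<omega>. (\<integral>\<^sup>+y. \<phi> \<omega> \<one> * (cluster_avg n \<omega> (f \<omega>) y * indicator (cluster \<omega> \<one>) y) \<partial>walk n \<one>) \<partial>M)"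
  proof (rule mass_transport[symmetric])
    fix x y assume xy: "x \<in> carrier G" "y \<in> carrier G"
    show "(\<lambda>\<omega>. \<phi> \<omega> x * (cluster_avg n \<omega> (f \<omega>) y * indicator (cluster \<omega> x) y)) \<in> borel_measurable M"
      using xy by (intro borel_measurable_times_ennreal cluster_avg_measurable indicator_cluster_measurable) auto
    fix g \<omega> assume g: "g \<in> carrier G" and \<omega>: "\<omega> \<in> space M"
    show "\<phi> (\<theta> g \<omega>) x * (cluster_avg n (\<theta> g \<omega>) (f (\<theta> g \<omega>)) y * indicator (cluster (\<theta> g \<omega>) x) y)
        = \<phi> \<omega> (g \<otimes> x) * (cluster_avg n \<omega> (f \<omega>) (g \<otimes> y) * indicator (cluster \<omega> (g \<otimes> x)) (g \<otimes> y))"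
      using xy g \<omega> cluster_avg_shift[of g y \<omega> "f (\<theta> g \<omega>)" "f \<omega>" n] by (simp add: shift ind_shift)
  qed
  also have "\<dots> = (\<integral>\<^sup>+\<omega>. \<phi> \<omega> \<one> * cluster_avg n \<omega> (cluster_avg n \<omega> (f \<omega>)) \<one> \<partial>M)"
    unfolding cluster_avg_def[of n _ "cluster_avg _ _ _"] by (simp add: nn_integral_cmult)
  also have "\<dots> \<le> (\<integral>\<^sup>+\<omega>. \<phi> \<omega> \<one> * ennreal (R \<omega> \<one>) \<partial>M)"
    by (intro nn_integral_mono mult_left_mono two_steps) simp
  also have "\<dots> = (\<integral>\<^sup>+\<omega>. 1 \<partial>M)"
    using R_pos by (intro nn_integral_cong)
      (simp add: \<phi>_def ennreal_mult[symmetric] less_imp_le less_imp_neq[symmetric])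
  also have "\<dots> = 1" by (simp add: emeasure_space_1)
  finally have second_moment: "(\<integral>\<^sup>+\<omega>. (cluster_avg n \<omega> (h \<omega>) \<one>)\<^sup>2 \<partial>M) \<le> 1" .

  have [measurable]: "(\<lambda>\<omega>. cluster_avg n \<omega> (h \<omega>) \<one>) \<in> borel_measurable M"
    by (intro cluster_avg_measurable) auto
  have "(\<integral>\<^sup>+\<omega>. cluster_avg n \<omega> (h \<omega>) \<one> \<partial>M)\<^sup>2 \<le> 1"
    using Cauchy_Schwarz_nn_integral[of "\<lambda>\<omega>. cluster_avg n \<omega> (h \<omega>) \<one>" M "\<lambda>_. 1"] second_moment
    by (simp add: emeasure_space_1 order_trans)
  then have first_moment: "(\<integral>\<^sup>+\<omega>. cluster_avg n \<omega> (h \<omega>) \<one> \<partial>M) \<le> 1"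
    using mult_left_mono[of 1 "\<integral>\<^sup>+\<omega>. cluster_avg n \<omega> (h \<omega>) \<one> \<partial>M"
        "\<integral>\<^sup>+\<omega>. cluster_avg n \<omega> (h \<omega>) \<one> \<partial>M"]
    by (cases "1 \<le> (\<integral>\<^sup>+\<omega>. cluster_avg n \<omega> (h \<omega>) \<one> \<partial>M)")
       (auto simp: power2_eq_square intro: order_trans)
  have "(\<integral>\<^sup>+\<omega>. ennreal (ret n \<omega> \<one> * sqrt (ret m \<omega> \<one> / ret (2 * n + m) \<omega> \<one>)) \<partial>M)
      = (\<integral>\<^sup>+\<omega>. (\<integral>\<^sup>+y. h \<omega> \<one> * indicator (cluster \<omega> \<one>) y \<partial>walk n \<one>) \<partial>M)"
  proof (intro nn_integral_cong)
    fix \<omega>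
    have "(\<integral>\<^sup>+y. h \<omega> \<one> * indicator (cluster \<omega> \<one>) y \<partial>walk n \<one>) = h \<omega> \<one> * ennreal (ret n \<omega> \<one>)"
      by (simp add: nn_integral_cmult ret_def measure_pmf.emeasure_eq_measure)
    then show "ennreal (ret n \<omega> \<one> * sqrt (ret m \<omega> \<one> / ret (2 * n + m) \<omega> \<one>))
        = (\<integral>\<^sup>+y. h \<omega> \<one> * indicator (cluster \<omega> \<one>) y \<partial>walk n \<one>)"
      using ret_pos[of _ \<omega> \<one>] by (simp add: h_def R_def ennreal_mult less_imp_le mult.commute)
  qed
  also have "\<dots> = (\<integral>\<^sup>+\<omega>. (\<integral>\<^sup>+y. h \<omega> y * indicator (cluster \<omega> y) \<one> \<partial>walk n \<one>) \<partial>M)"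
  proof (rule mass_transport)
    fix x y assume xy: "x \<in> carrier G" "y \<in> carrier G"
    show "(\<lambda>\<omega>. h \<omega> x * indicator (cluster \<omega> x) y) \<in> borel_measurable M"
      using xy by (intro borel_measurable_times_ennreal indicator_cluster_measurable) auto
    fix g \<omega> assume g: "g \<in> carrier G" and \<omega>: "\<omega> \<in> space M"
    show "h (\<theta> g \<omega>) x * indicator (cluster (\<theta> g \<omega>) x) y
        = h \<omega> (g \<otimes> x) * indicator (cluster \<omega> (g \<otimes> x)) (g \<otimes> y)"
      using xy g \<omega> by (simp add: shift ind_shift)
  qed
  also have "\<dots> = (\<integral>\<^sup>+\<omega>. cluster_avg n \<omega> (h \<omega>) \<one> \<partial>M)"
    unfolding cluster_avg_def by (intro nn_integral_cong) (simp add: indicator_def cluster_sym)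
  finally show ?thesis using first_moment by simp
qed

section \<open>Almost sure existence of the limit\<close>

text \<open>The ratios of \<open>expected_ret_ratio_le_1\<close> have expectation at most \<open>1\<close>, so their sum against the weights
  \<open>1 / ((n + 1)\<^sup>2 * (m + 1)\<^sup>2)\<close> is almost surely finite. This sum serves as the constant in a
  polynomial bound for all of the ratios at once.\<close>

lemma AE_ln_ret_limit_one: "AE \<omega> in M. \<exists>l. (\<lambda>n. ln (ret n \<omega> \<one>) / n) \<longlonglongrightarrow> l"
proof -
  define c where "c n = 1 / (real n + 1)\<^sup>2" for n :: nat
  define X where "X n m \<omega> = ret n \<omega> \<one> * sqrt (ret m \<omega> \<one> / ret (2 * n + m) \<omega> \<one>)" for n m \<omega>
  define Z where "Z \<omega> = (\<Sum>n. \<Sum>m. ennreal (c n) * (ennreal (c m) * ennreal (X n m \<omega>)))" for \<omega>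
  have c_pos: "0 < c n" for n by (simp add: c_def add_pos_nonneg)
  have X_nonneg: "0 \<le> X n m \<omega>" for n m \<omega> by (simp add: X_def ret_def)
  have [measurable]: "(\<lambda>\<omega>. X n m \<omega>) \<in> borel_measurable M" for n m
    unfolding X_def using ret_measurable[OF one_closed] by measurable
  have "summable (\<lambda>n. inverse (real (Suc n) ^ 2))"
    using inverse_power_summable[of 2, where 'a = real] by (subst summable_Suc_iff) auto
  moreover have "c = (\<lambda>n. inverse (real (Suc n) ^ 2))"
    by (auto simp: c_def inverse_eq_divide add.commute)
  ultimately have "summable c" by simp
  then have c_sum: "(\<Sum>n. ennreal (c n)) < \<infinity>"
    using c_pos by (simp add: ennreal_suminf_neq_top less_top less_imp_le)
  have "(\<integral>\<^sup>+\<omega>. Z \<omega> \<partial>M) = (\<Sum>n. \<Sum>m. ennreal (c n) * (ennreal (c m) * (\<integral>\<^sup>+\<omega>. ennreal (X n m \<omega>) \<partial>M)))"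
    unfolding Z_def by (simp add: nn_integral_suminf nn_integral_cmult)
  also have "\<dots> \<le> (\<Sum>n. \<Sum>m. ennreal (c n) * (ennreal (c m) * 1))"
    using expected_ret_ratio_le_1 unfolding X_def
    by (intro suminf_le mult_left_mono summableI) auto
  also have "\<dots> = (\<Sum>n. ennreal (c n)) * (\<Sum>n. ennreal (c n))"
    by (simp add: ennreal_suminf_cmult ennreal_suminf_multc)
  also have "\<dots> < \<infinity>" using c_sum by (simp add: ennreal_mult_less_top)
  finally have "(\<integral>\<^sup>+\<omega>. Z \<omega> \<partial>M) \<noteq> \<infinity>" by simp
  then have "AE \<omega> in M. Z \<omega> \<noteq> \<infinity>"
    by (intro nn_integral_noteq_infinite) (simp_all add: Z_def)
  then show ?thesis
  proof eventually_elim
    case (elim \<omega>)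
    define W where "W = max 1 (enn2real (Z \<omega>))"
    show ?case
    proof (rule ln_rate_convergent[OF ret_0 ret_le_1 a_pos ret_Suc_ge, where W = W])
      show "1 \<le> W" by (simp add: W_def)
      fix n m
      have "ennreal (c n) * (ennreal (c m) * ennreal (X n m \<omega>))
          \<le> (\<Sum>m. ennreal (c n) * (ennreal (c m) * ennreal (X n m \<omega>)))"
        using sum_le_suminf[of "\<lambda>m. ennreal (c n) * (ennreal (c m) * ennreal (X n m \<omega>))" "{m}"] by simp
      also have "\<dots> \<le> Z \<omega>"
        unfolding Z_def
        using sum_le_suminf[of "\<lambda>n. \<Sum>m. ennreal (c n) * (ennreal (c m) * ennreal (X n m \<omega>))" "{n}"] by simp
      also have "\<dots> = ennreal (enn2real (Z \<omega>))" using elim by (simp add: less_top)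
      also have "\<dots> \<le> ennreal W" by (simp add: W_def ennreal_leI)
      finally have "c n * (c m * X n m \<omega>) \<le> W"
        using c_pos X_nonneg by (simp add: ennreal_mult[symmetric] less_imp_le W_def)
      then show "ret n \<omega> \<one> * sqrt (ret m \<omega> \<one> / ret (2 * n + m) \<omega> \<one>) \<le> W * (real n + 1)\<^sup>2 * (real m + 1)\<^sup>2"
        unfolding X_def[symmetric] by (simp add: c_def field_simps)
    qed
  qed
qed

lemma AE_ln_ret_limit: "AE \<omega> in M. \<forall>x\<in>carrier G. \<exists>l. (\<lambda>n. ln (ret n \<omega> x) / n) \<longlonglongrightarrow> l"
proof (rule AE_ball_countable'[OF _ countable_carrier])
  fix x assume x: "x \<in> carrier G"
  have "AE \<omega> in distr M M (\<theta> x). \<exists>l. (\<lambda>n. ln (ret n \<omega> \<one>) / n) \<longlonglongrightarrow> l"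
    unfolding shift_invariant[OF x] by (rule AE_ln_ret_limit_one)
  from AE_distrD[OF shift_measurable[OF x] this] AE_space
  show "AE \<omega> in M. \<exists>l. (\<lambda>n. ln (ret n \<omega> x) / n) \<longlonglongrightarrow> l"
  proof eventually_elim
    case (elim \<omega>)
    then show ?case using x by (simp add: ret_shift)
  qed
qed

theorem AE_root_hit_prob_convergent:
  "AE \<omega> in M. \<forall>x\<in>carrier G. \<exists>\<rho>. (\<lambda>n. root n (hit_prob G S a n (cluster \<omega> x))) \<longlonglongrightarrow> \<rho>"
  using AE_ln_ret_limit
proof eventually_elim
  case (elim \<omega>)
  show ?case
  proof
    fix x assume x: "x \<in> carrier G"
    obtain l where l: "(\<lambda>n. ln (ret n \<omega> x) / n) \<longlonglongrightarrow> l" using elim x by blast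
    \<comment> \<open>The identity reaches \<open>x\<close>, and \<open>x\<close> the identity, with the same positive probability in
      \<open>k\<close> steps, so the walks from both have the same rate of hitting the cluster.\<close>
    obtain k where k: "0 < pmf (walk k \<one>) x" using walk_reaches[OF x] by blast
    have "(\<lambda>n. root n (hit_prob G S a n (cluster \<omega> x))) \<longlonglongrightarrow> exp l"
    proof (rule root_limit_of_mutual_domination[OF ret_pos l k])
      show "0 \<le> hit_prob G S a n (cluster \<omega> x)" for n by (simp add: hit_prob_def)
      show "pmf (walk k \<one>) x * ret n \<omega> x \<le> hit_prob G S a (n + k) (cluster \<omega> x)" for n
        using prob_walk_add_ge[of k \<one> x n "cluster \<omega> x"]
        by (simp add: hit_prob_eq ret_def add.commute[of k n])
      show "pmf (walk k \<one>) x * hit_prob G S a n (cluster \<omega> x) \<le> ret (n + k) \<omega> x" for n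
        using prob_walk_add_ge[of k x \<one> n "cluster \<omega> x"] pmf_walk_sym[OF one_closed x]
        by (simp add: hit_prob_eq ret_def add.commute[of k n])
    qed
    then show "\<exists>\<rho>. (\<lambda>n. root n (hit_prob G S a n (cluster \<omega> x))) \<longlonglongrightarrow> \<rho>" by blast
  qed
qed

end

section \<open>Bernoulli percolation as an invariant random graph\<close>

lemma prob_space_percolation: "prob_space (percolation I p)"
  unfolding percolation_def by (intro prob_space_PiM prob_space_measure_pmf)

lemma percolation_open_measurable:
  assumes "i \<in> I"
  shows "{\<omega> \<in> space (percolation I p). \<omega> i} \<in> sets (percolation I p)"
proof -
  have "(\<lambda>\<omega>. \<omega> i) \<in> measurable (percolation I p) (measure_pmf (bernoulli_pmf p))"
    unfolding percolation_def by (rule measurable_component_singleton[OF assms])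
  from measurable_sets[OF this, of "{True}"] show ?thesis by (simp add: vimage_def Int_def conj_commute)
qed

lemma percolation_reindex:
  assumes "inj_on f I" "f \<in> I \<rightarrow> I"
  shows "(\<lambda>\<omega>. \<lambda>i\<in>I. \<omega> (f i)) \<in> measurable (percolation I p) (percolation I p)"
    and "distr (percolation I p) (percolation I p) (\<lambda>\<omega>. \<lambda>i\<in>I. \<omega> (f i)) = percolation I p"
  using distr_PiM_reindex[of I "\<lambda>_. measure_pmf (bernoulli_pmf p)" f I] assms
  by (auto simp: percolation_def prob_space_measure_pmf intro!: measurable_restrict measurable_component_singleton)

text \<open>For the component of a vertex of \<open>V\<close>, the requirement that its elements lie in \<open>V\<close> is
  redundant.\<close>

lemma connected_rel_class:
  assumes "x \<in> V"
  shows "connected_rel V E `` {x} = {(u, v). u \<in> V \<and> v \<in> V \<and> {u, v} \<in> E}\<^sup>* `` {x}"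
proof -
  have "y \<in> V" if "(x, y) \<in> {(u, v). u \<in> V \<and> v \<in> V \<and> {u, v} \<in> E}\<^sup>*" for y
    using that assms by induction auto
  then show ?thesis using assms unfolding connected_rel_def by blast
qed

context group
begin

lemma cayley_edges_translate:
  assumes "S \<subseteq> carrier G" "g \<in> carrier G" "e \<in> cayley_edges G S"
  shows "(\<lambda>x. g \<otimes> x) ` e \<in> cayley_edges G S"
proof -
  obtain x s where "e = {x, x \<otimes> s}" "x \<in> carrier G" "s \<in> S"
    using assms(3) by (auto simp: cayley_edges_def)
  then have "(\<lambda>x. g \<otimes> x) ` e = {g \<otimes> x, (g \<otimes> x) \<otimes> s}" "g \<otimes> x \<in> carrier G" "s \<in> S"
    using assms by (auto simp: m_assoc subset_iff)
  then show ?thesis unfolding cayley_edges_def by blast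
qed

lemma cayley_edges_translate_iff:
  assumes "S \<subseteq> carrier G" "g \<in> carrier G" "x \<in> carrier G" "y \<in> carrier G"
  shows "{g \<otimes> x, g \<otimes> y} \<in> cayley_edges G S \<longleftrightarrow> {x, y} \<in> cayley_edges G S"
proof
  assume "{g \<otimes> x, g \<otimes> y} \<in> cayley_edges G S"
  then have "(\<lambda>x. inv g \<otimes> x) ` {g \<otimes> x, g \<otimes> y} \<in> cayley_edges G S"
    using assms by (intro cayley_edges_translate) auto
  then show "{x, y} \<in> cayley_edges G S" using assms by (simp add: m_assoc[symmetric])
next
  assume "{x, y} \<in> cayley_edges G S"
  then show "{g \<otimes> x, g \<otimes> y} \<in> cayley_edges G S"
    using cayley_edges_translate[OF assms(1,2), of "{x, y}"] by simp
qed

lemma inj_on_translate_edges: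
  assumes "S \<subseteq> carrier G" "g \<in> carrier G"
  shows "inj_on (\<lambda>e. (\<lambda>x. g \<otimes> x) ` e) (cayley_edges G S)"
proof (rule inj_on_subset)
  show "inj_on (\<lambda>e. (\<lambda>x. g \<otimes> x) ` e) (Pow (carrier G))"
    using inj_on_cmult[OF assms(2)] by (rule inj_on_image_Pow)
  show "cayley_edges G S \<subseteq> Pow (carrier G)"
    using assms(1) by (auto simp: cayley_edges_def)
qed

end

theorem theorem1p1:
  fixes G :: "('a, 'b) monoid_scheme" and S :: "'a set" and p a :: real
  assumes "group G"
    and "infinite (carrier G)" and "countable (carrier G)"
    and "S \<subseteq> carrier G" and "finite S"
    and "\<forall>s\<in>S. inv\<^bsub>G\<^esub> s \<in> S"
    and "generate G S = carrier G"
    and "0 \<le> p" and "p \<le> 1"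
    and "0 < a" and "a < 1"
  shows "(AE \<omega> in percolation (cayley_edges G S) p. \<forall>C \<in> bond_clusters G S \<omega>.
            \<exists>\<rho>. (\<lambda>n. root n (hit_prob G S a n C)) \<longlonglongrightarrow> \<rho>) \<and>
         (AE \<omega> in percolation (carrier G) p. \<forall>C \<in> site_clusters G S \<omega>.
            \<exists>\<rho>. (\<lambda>n. root n (hit_prob G S a n C)) \<longlonglongrightarrow> \<rho>)"
proof -
  interpret group G by fact
  have "S \<noteq> {}"
  proof
    assume "S = {}"
    then have "carrier G = {\<one>\<^bsub>G\<^esub>}" using assms(7) generate_empty by simp
    then show False using assms(2) by simp
  qed
  then interpret lazy_walk_on_group G S a
    using assms by unfold_locales auto
  let ?E = "cayley_edges G S"
  note edge_iff = cayley_edges_translate_iff[OF S_carrier]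

  define Qb where "Qb \<omega> = {(u, v). u \<in> carrier G \<and> v \<in> carrier G \<and> {u, v} \<in> {e \<in> ?E. \<omega> e}}"
    for \<omega> :: "'a set \<Rightarrow> bool"
  define \<theta>b where "\<theta>b g \<omega> = (\<lambda>e\<in>?E. \<omega> ((\<lambda>x. g \<otimes>\<^bsub>G\<^esub> x) ` e))" for g and \<omega> :: "'a set \<Rightarrow> bool"
  interpret bond: invariant_random_graph G S a "percolation ?E p" Qb \<theta>b
  proof (intro invariant_random_graph.intro invariant_random_graph_axioms.intro
      lazy_walk_on_group_axioms prob_space_percolation)
    show "countable (carrier G)" by fact
    show "Qb \<omega> \<subseteq> carrier G \<times> carrier G" "sym (Qb \<omega>)" for \<omega>
      by (auto simp: Qb_def sym_def insert_commute)
    show "{\<omega> \<in> space (percolation ?E p). (x, y) \<in> Qb \<omega>} \<in> sets (percolation ?E p)"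
      if "x \<in> carrier G" "y \<in> carrier G" for x y
      using that percolation_open_measurable[of "{x, y}" ?E p]
      by (cases "{x, y} \<in> ?E") (auto simp: Qb_def)
    fix g assume g: "g \<in> carrier G"
    have "(\<lambda>e. (\<lambda>x. g \<otimes>\<^bsub>G\<^esub> x) ` e) \<in> ?E \<rightarrow> ?E"
      using cayley_edges_translate[OF S_carrier g] by blast
    note reindex = percolation_reindex[OF inj_on_translate_edges[OF S_carrier g] this, where p = p]
    show "\<theta>b g \<in> measurable (percolation ?E p) (percolation ?E p)"
      "distr (percolation ?E p) (percolation ?E p) (\<theta>b g) = percolation ?E p"
      using reindex by (simp_all add: \<theta>b_def[abs_def])
    show "(x, y) \<in> Qb (\<theta>b g \<omega>) \<longleftrightarrow> (g \<otimes>\<^bsub>G\<^esub> x, g \<otimes>\<^bsub>G\<^esub> y) \<in> Qb \<omega>"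
      if "x \<in> carrier G" "y \<in> carrier G" for x y \<omega>
      using that g by (auto simp: Qb_def \<theta>b_def edge_iff)
  qed

  \<comment> \<open>Removed vertices are isolated in \<open>Qs \<omega>\<close>: they form singleton components there, which are not
    clusters of the site percolation. All other components agree.\<close>
  define Qs where "Qs \<omega> = {(u, v). u \<in> {x \<in> carrier G. \<omega> x} \<and> v \<in> {x \<in> carrier G. \<omega> x} \<and>
      {u, v} \<in> {e \<in> ?E. \<forall>x\<in>e. \<omega> x}}" for \<omega> :: "'a \<Rightarrow> bool"
  define \<theta>s where "\<theta>s g \<omega> = (\<lambda>x\<in>carrier G. \<omega> (g \<otimes>\<^bsub>G\<^esub> x))" for g and \<omega> :: "'a \<Rightarrow> bool"
  interpret site: invariant_random_graph G S a "percolation (carrier G) p" Qs \<theta>s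
  proof (intro invariant_random_graph.intro invariant_random_graph_axioms.intro
      lazy_walk_on_group_axioms prob_space_percolation)
    show "countable (carrier G)" by fact
    show "Qs \<omega> \<subseteq> carrier G \<times> carrier G" "sym (Qs \<omega>)" for \<omega>
      by (auto simp: Qs_def sym_def insert_commute)
    show "{\<omega> \<in> space (percolation (carrier G) p). (x, y) \<in> Qs \<omega>} \<in> sets (percolation (carrier G) p)"
      if "x \<in> carrier G" "y \<in> carrier G" for x y
    proof (cases "{x, y} \<in> ?E")
      case True
      then have "{\<omega> \<in> space (percolation (carrier G) p). (x, y) \<in> Qs \<omega>}
          = {\<omega> \<in> space (percolation (carrier G) p). \<omega> x} \<inter> {\<omega> \<in> space (percolation (carrier G) p). \<omega> y}"
        using that by (auto simp: Qs_def)
      then show ?thesis using that by (simp add: percolation_open_measurable sets.Int)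
    qed (simp add: Qs_def)
    fix g assume g: "g \<in> carrier G"
    have "(\<lambda>x. g \<otimes>\<^bsub>G\<^esub> x) \<in> carrier G \<rightarrow> carrier G" using g by simp
    note reindex = percolation_reindex[OF inj_on_cmult[OF g] this, where p = p]
    show "\<theta>s g \<in> measurable (percolation (carrier G) p) (percolation (carrier G) p)"
      "distr (percolation (carrier G) p) (percolation (carrier G) p) (\<theta>s g) = percolation (carrier G) p"
      using reindex by (simp_all add: \<theta>s_def[abs_def])
    show "(x, y) \<in> Qs (\<theta>s g \<omega>) \<longleftrightarrow> (g \<otimes>\<^bsub>G\<^esub> x, g \<otimes>\<^bsub>G\<^esub> y) \<in> Qs \<omega>"
      if "x \<in> carrier G" "y \<in> carrier G" for x y \<omega>
      using that g by (auto simp: Qs_def \<theta>s_def edge_iff)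
  qed

  have "AE \<omega> in percolation ?E p. \<forall>C \<in> bond_clusters G S \<omega>.
      \<exists>\<rho>. (\<lambda>n. root n (hit_prob G S a n C)) \<longlonglongrightarrow> \<rho>"
    using bond.AE_root_hit_prob_convergent
  proof eventually_elim
    case (elim \<omega>)
    show ?case
    proof
      fix C assume "C \<in> bond_clusters G S \<omega>"
      then obtain x where "x \<in> carrier G" "C = bond.cluster \<omega> x"
        by (auto simp: bond_clusters_def graph_components_def bond.cluster_def Qb_def
            connected_rel_class elim!: quotientE)
      with elim show "\<exists>\<rho>. (\<lambda>n. root n (hit_prob G S a n C)) \<longlonglongrightarrow> \<rho>" by blast
    qed
  qed
  moreover have "AE \<omega> in percolation (carrier G) p. \<forall>C \<in> site_clusters G S \<omega>.
      \<exists>\<rho>. (\<lambda>n. root n (hit_prob G S a n C)) \<longlonglongrightarrow> \<rho>"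
    using site.AE_root_hit_prob_convergent
  proof eventually_elim
    case (elim \<omega>)
    show ?case
    proof
      fix C assume "C \<in> site_clusters G S \<omega>"
      then obtain x where "x \<in> {x \<in> carrier G. \<omega> x}" "C = site.cluster \<omega> x"
        unfolding site_clusters_def graph_components_def site.cluster_def Qs_def
        by (elim quotientE) (simp only: connected_rel_class)
      with elim show "\<exists>\<rho>. (\<lambda>n. root n (hit_prob G S a n C)) \<longlonglongrightarrow> \<rho>" by blast
    qed
  qed
  ultimately show ?thesis by blast
qed

end
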